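(* Let $q\geq 2$ and $\gamma$ be integers such that Condition 1 holds for $q$ and $\gamma$. Then there is a completely regular code in $H(3,q)$ with covering radius $1$, eigenvalue $\lambda_2(3,q)$ and parameter $\gamma$.
   Context: Let $\mathcal{A}$ be a set of size $q$; $H(3,q)$ has vertex set $\mathcal{A}^3$, tuples adjacent iff they differ in exactly one position; $\lambda_2(3,q)=q-3$. A set $C$ of vertices is a completely regular code with covering radius $1$ if $C$ is a nonempty proper subset and there are integers $\beta,\gamma\geq1$ such that every vertex of $C$ has exactly $\beta$ neighbours outside $C$ and every vertex outside $C$ has exactly $\gamma$ neighbours in $C$; it has eigenvalue $\lambda_2(3,q)$ iff $3(q-1)-(\beta+\gamma)=q-3$, i.e. $\beta+\gamma=2q$. Condition 1 (for $q$ and $\gamma$): there exist integers $r,s,t$ with $0<r,s,t<q$ and integers $a,b,c$ with $0<c\leq\min\{q-s,q-t\}$, $0<b\leq \min\{t,q-r\}$, $0<a\leq\min\{r,s\}$ such that $cr=a(q-t)$, $b(q-s)=c(q-r)$, $at=bs$, and $\gamma=a+b+c$. *)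

theory Defs
  imports Main "Graph_Theory.Pair_Digraph"
begin

text \<open>
  Undirected graphs are symmetric digraphs, so each edge contributes both ordered pairs to
  \<open>parcs\<close>. A vertex of the Hamming graph \<open>H(n,q)\<close> is a list of length \<open>n\<close> over an alphabet
  \<open>A\<close> with \<open>q\<close> elements.
\<close>

definition hamming_graph :: "nat \<Rightarrow> 'a set \<Rightarrow> 'a list pair_pre_digraph" where
  "hamming_graph n A =
     \<lparr> pverts = {xs. length xs = n \<and> set xs \<subseteq> A},
       parcs = {(xs, ys). length xs = n \<and> set xs \<subseteq> A \<and> length ys = n \<and> set ys \<subseteq> A \<and>
                  card {i. i < n \<and> xs ! i \<noteq> ys ! i} = 1} \<rparr>"

definition neighbours :: "'v pair_pre_digraph \<Rightarrow> 'v \<Rightarrow> 'v set" where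
  "neighbours G v = {w. (v, w) \<in> parcs G}"

definition hamming_eigenvalue :: "nat \<Rightarrow> nat \<Rightarrow> int \<Rightarrow> int" where
  "hamming_eigenvalue i n q = int n * (q - 1) - int i * q"

definition completely_regular_code_radius1 ::
    "'v pair_pre_digraph \<Rightarrow> 'v set \<Rightarrow> int \<Rightarrow> int \<Rightarrow> bool" where
  "completely_regular_code_radius1 G C \<beta> \<gamma> \<longleftrightarrow>
     C \<noteq> {} \<and> C \<subset> pverts G \<and> \<beta> \<ge> 1 \<and> \<gamma> \<ge> 1 \<and>
     (\<forall>v\<in>C. int (card (neighbours G v - C)) = \<beta>) \<and>
     (\<forall>v\<in>pverts G - C. int (card (neighbours G v \<inter> C)) = \<gamma>)"

text \<open>
  In a \<open>k\<close>-regular graph the partition into a code and its complement has quotient matrix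
  with rows \<open>(k - \<beta>, \<beta>)\<close> and \<open>(\<gamma>, k - \<gamma>)\<close>. Its eigenvalues are \<open>k\<close> and the following one,
  which is the eigenvalue of the code.
\<close>

definition code_eigenvalue :: "int \<Rightarrow> int \<Rightarrow> int \<Rightarrow> int" where
  "code_eigenvalue k \<beta> \<gamma> = k - (\<beta> + \<gamma>)"

definition condition1 :: "int \<Rightarrow> int \<Rightarrow> bool" where
  "condition1 q \<gamma> \<longleftrightarrow>
     (\<exists>r s t a b c :: int.
        0 < r \<and> r < q \<and> 0 < s \<and> s < q \<and> 0 < t \<and> t < q \<and>
        0 < c \<and> c \<le> min (q - s) (q - t) \<and>
        0 < b \<and> b \<le> min t (q - r) \<and>
        0 < a \<and> a \<le> min r s \<and>
        c * r = a * (q - t) \<and> b * (q - s) = c * (q - r) \<and> a * t = b * s \<and>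
        \<gamma> = a + b + c)"

lemma hamming_eigenvalue_2_3: "hamming_eigenvalue 2 3 q = q - 3"
  by (simp add: hamming_eigenvalue_def)

lemma hamming_graph_pair_graph:
  assumes "finite A"
  shows "pair_graph (hamming_graph n A)"
proof
  have "pverts (hamming_graph n A) = {xs. set xs \<subseteq> A \<and> length xs = n}"
    by (auto simp: hamming_graph_def)
  then show fin: "finite (pverts (hamming_graph n A))"
    by (simp only: finite_lists_length_eq[OF assms])
  have "parcs (hamming_graph n A) \<subseteq> pverts (hamming_graph n A) \<times> pverts (hamming_graph n A)"
    by (auto simp: hamming_graph_def)
  then show "finite (parcs (hamming_graph n A))"
    by (rule finite_subset) (intro finite_cartesian_product fin)
  have swap: "{i. i < n \<and> xs ! i \<noteq> ys ! i} = {i. i < n \<and> ys ! i \<noteq> xs ! i}" for xs ys :: "'a list"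
    by (rule Collect_cong) metis
  have "sym (parcs (hamming_graph n A))"
    unfolding hamming_graph_def by (rule symI) (simp del: One_nat_def add: swap)
  then show "symmetric (with_proj (hamming_graph n A))"
    by (simp only: symmetric_def with_proj_simps)
next
  fix e assume e: "e \<in> parcs (hamming_graph n A)"
  obtain xs ys where [simp]: "e = (xs, ys)" by (cases e)
  from e show "fst e \<in> pverts (hamming_graph n A)" by (simp add: hamming_graph_def)
  from e show "snd e \<in> pverts (hamming_graph n A)" by (simp add: hamming_graph_def)
  from e have "card {i. i < n \<and> xs ! i \<noteq> ys ! i} = 1" by (simp add: hamming_graph_def)
  then show "fst e \<noteq> snd e" by (cases "xs = ys") simp_all
qed

lemma card_neighbours_hamming_graph:
  assumes A: "finite A" and xs: "xs \<in> pverts (hamming_graph n A)"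
  shows "card (neighbours (hamming_graph n A) xs) = n * (card A - 1)"
proof -
  define N where "N i = (\<lambda>a. xs[i := a]) ` (A - {xs ! i})" for i
  have len: "length xs = n" and sub: "set xs \<subseteq> A"
    using xs by (auto simp: hamming_graph_def)
  have "neighbours (hamming_graph n A) xs = (\<Union>i<n. N i)"
  proof (intro equalityI subsetI)
    fix ys assume "ys \<in> neighbours (hamming_graph n A) xs"
    then have ys: "length ys = n" "set ys \<subseteq> A" "card {i. i < n \<and> xs ! i \<noteq> ys ! i} = 1"
      by (auto simp: neighbours_def hamming_graph_def)
    from ys(3) obtain i where i: "{i. i < n \<and> xs ! i \<noteq> ys ! i} = {i}"
      by (auto simp: card_1_singleton_iff)
    then have *: "i < n" "xs ! i \<noteq> ys ! i" by auto
    have eq: "xs ! j = ys ! j" if "j < n" "j \<noteq> i" for j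
      using i that by blast
    have "ys = xs[i := ys ! i]"
    proof (rule nth_equalityI)
      fix j assume "j < length ys"
      then show "ys ! j = xs[i := ys ! i] ! j"
        using len ys(1) eq[of j] by (cases "j = i") auto
    qed (use len ys in simp)
    moreover have "ys ! i \<in> A - {xs ! i}"
      using * ys by (auto simp: subset_iff)
    ultimately have "ys \<in> N i" unfolding N_def by (rule image_eqI)
    then show "ys \<in> (\<Union>i<n. N i)" using * by blast
  next
    fix ys assume "ys \<in> (\<Union>i<n. N i)"
    then obtain i a where i: "i < n" "a \<in> A" "a \<noteq> xs ! i" "ys = xs[i := a]"
      by (auto simp: N_def)
    have "xs ! j \<noteq> ys ! j \<longleftrightarrow> j = i" if "j < n" for j
      using i len that by (cases "j = i") auto
    then have "{j. j < n \<and> xs ! j \<noteq> ys ! j} = {i}"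
      using i(1) by auto
    moreover have "set ys \<subseteq> A"
      using i sub set_update_subset_insert[of xs i a] by auto
    ultimately show "ys \<in> neighbours (hamming_graph n A) xs"
      using i len sub by (simp add: neighbours_def hamming_graph_def)
  qed
  also have "card (\<Union>i<n. N i) = (\<Sum>i<n. card (N i))"
  proof (rule card_UN_disjoint)
    show "\<forall>i\<in>{..<n}. \<forall>j\<in>{..<n}. i \<noteq> j \<longrightarrow> N i \<inter> N j = {}"
    proof (intro ballI impI equals0I)
      fix i j ys assume h: "i \<in> {..<n}" "j \<in> {..<n}" "i \<noteq> j" "ys \<in> N i \<inter> N j"
      then obtain a b where "a \<noteq> xs ! i" "ys = xs[i := a]" "ys = xs[j := b]"
        unfolding N_def by blast
      then have "ys ! i \<noteq> xs ! i" "ys ! i = xs ! i"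
        using h(1,3) len by (metis lessThan_iff nth_list_update_eq, metis nth_list_update_neq)
      then show False by contradiction
    qed
  qed (simp_all add: N_def A)
  also have "\<dots> = (\<Sum>i<n. card A - 1)"
  proof (rule sum.cong)
    fix i assume i: "i \<in> {..<n}"
    have "inj_on (\<lambda>a. xs[i := a]) (A - {xs ! i})"
      by (rule inj_on_inverseI[where g = "\<lambda>ys. ys ! i"]) (use i len in auto)
    moreover have "xs ! i \<in> A" using i len sub by auto
    ultimately show "card (N i) = card A - 1"
      using A by (simp add: N_def card_image)
  qed simp
  finally show ?thesis by simp
qed

end

theory Submission
  imports Defs
begin

text \<open>
  Choose \<open>X, Y, Z \<subseteq> A\<close> of sizes \<open>t, r, s\<close> and biregular relations \<open>F \<subseteq> X \<times> Z\<close>,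
  \<open>G \<subseteq> (A - Z) \<times> (A - Y)\<close>, \<open>H \<subseteq> Y \<times> (A - X)\<close> with row and column sums \<open>(a, b)\<close>, \<open>(b, c)\<close>,
  \<open>(c, a)\<close>; the three equations of Condition 1 are the double counting conditions for these.
  Let \<open>C\<close> consist of the \<open>(x, y, z)\<close> with \<open>(x, z) \<in> F\<close>, \<open>(z, y) \<in> G\<close> or \<open>(y, x) \<in> H\<close>, which
  exclude each other. The numbers of code points on the three lines through \<open>(x, y, z)\<close> are
  \<open>b[z \<in> Z] + c[y \<in> Y] + q[(z, y) \<in> G]\<close>, \<open>b[z \<notin> Z] + a[x \<notin> X] + q[(x, z) \<in> F]\<close> and
  \<open>a[x \<in> X] + c[y \<notin> Y] + q[(y, x) \<in> H]\<close>. They add up to \<open>a + b + c\<close>, plus \<open>q\<close> for points of \<open>C\<close>.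
\<close>

section \<open>Biregular relations between finite sets\<close>

text \<open>
  The witness is \<open>{(k div a, k mod n) | k < m * a}\<close>: row \<open>i\<close> is a cyclic interval of length \<open>a\<close>
  that starts where row \<open>i - 1\<close> stops.
\<close>

lemma biregular_relation_nat:
  fixes a b m n :: nat
  assumes a: "0 < a" "a \<le> n" and eq: "m * a = n * b"
  obtains R where "R \<subseteq> {..<m} \<times> {..<n}"
    and "\<And>i. i < m \<Longrightarrow> card {j. (i, j) \<in> R} = a"
    and "\<And>j. j < n \<Longrightarrow> card {i. (i, j) \<in> R} = b"
proof
  define R where "R = (\<lambda>k. (k div a, k mod n)) ` {..<m * a}"
  have n: "0 < n" using a by simp
  show "R \<subseteq> {..<m} \<times> {..<n}"
    using a n by (auto simp: R_def less_mult_imp_div_less)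
  show "card {j. (i, j) \<in> R} = a" if i: "i < m" for i
  proof -
    have "{j. (i, j) \<in> R} = (\<lambda>l. (i * a + l) mod n) ` {..<a}"
    proof (intro equalityI subsetI)
      fix j assume "j \<in> {j. (i, j) \<in> R}"
      then obtain k where "i = k div a" "j = k mod n" by (auto simp: R_def)
      then have "j = (i * a + k mod a) mod n" "k mod a < a" using a by simp_all
      then show "j \<in> (\<lambda>l. (i * a + l) mod n) ` {..<a}" by blast
    next
      fix j assume "j \<in> (\<lambda>l. (i * a + l) mod n) ` {..<a}"
      then obtain l where l: "l < a" "j = (i * a + l) mod n" by auto
      have "i * a + l < Suc i * a" using l by simp
      also have "\<dots> \<le> m * a" using i by (intro mult_le_mono1) simp
      finally have "i * a + l < m * a" .
      moreover have "(i * a + l) div a = i" using l by simp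
      ultimately show "j \<in> {j. (i, j) \<in> R}"
        unfolding R_def using l(2) by (auto intro!: image_eqI[of _ _ "i * a + l"])
    qed
    \<comment> \<open>Two offsets in a row differ by a positive number below
      \<open>a \<le> n\<close>, which \<open>n\<close> cannot divide.\<close>
    moreover have "inj_on (\<lambda>l. (i * a + l) mod n) {..<a}"
    proof (rule linorder_inj_onI)
      fix k l assume kl: "k < l" "k \<in> {..<a}" "l \<in> {..<a}"
      show "(i * a + k) mod n \<noteq> (i * a + l) mod n"
      proof
        assume "(i * a + k) mod n = (i * a + l) mod n"
        then have "n dvd (i * a + l) - (i * a + k)"
          using kl by (metis mod_eq_dvd_iff_nat add_le_cancel_left less_imp_le)
        then have "n dvd l - k" by simp
        then show False using kl a by (auto dest: dvd_imp_le)
      qed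
    qed auto
    ultimately show ?thesis by (simp add: card_image)
  qed
  show "card {i. (i, j) \<in> R} = b" if j: "j < n" for j
  proof -
    \<comment> \<open>Column \<open>j\<close> collects the \<open>k = l * n + j\<close>. By
      \<open>m * a = n * b\<close> the range of \<open>k\<close> is exactly \<open>b\<close> full
      periods, hence \<open>l < b\<close>.\<close>
    have "{i. (i, j) \<in> R} = (\<lambda>l. (l * n + j) div a) ` {..<b}"
    proof (intro equalityI subsetI)
      fix i assume "i \<in> {i. (i, j) \<in> R}"
      then obtain k where k: "k < n * b" "i = k div a" "j = k mod n"
        unfolding R_def eq by auto
      then have "i = (k div n * n + j) div a" "k div n < b"
        by (simp_all add: less_mult_imp_div_less mult.commute)
      then show "i \<in> (\<lambda>l. (l * n + j) div a) ` {..<b}" by blast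
    next
      fix i assume "i \<in> (\<lambda>l. (l * n + j) div a) ` {..<b}"
      then obtain l where l: "l < b" "i = (l * n + j) div a" by auto
      have "l * n + j < Suc l * n" using j by simp
      also have "\<dots> \<le> b * n" using l by (intro mult_le_mono1) simp
      also have "\<dots> = m * a" unfolding eq by (rule mult.commute)
      finally have "l * n + j < m * a" .
      moreover have "(l * n + j) mod n = j" using j by simp
      ultimately show "i \<in> {i. (i, j) \<in> R}"
        unfolding R_def using l(2) by (auto intro!: image_eqI[of _ _ "l * n + j"])
    qed
    \<comment> \<open>Successive \<open>k\<close> in a column are \<open>n \<ge> a\<close> apart, so
      their quotients by \<open>a\<close> increase strictly and no row is hit twice.\<close>
    moreover have "inj_on (\<lambda>l. (l * n + j) div a) {..<b}"
    proof (rule linorder_inj_onI)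
      fix k l :: nat assume kl: "k < l"
      have "(k * n + j) div a < (k * n + j + a) div a" using a by simp
      also have "\<dots> \<le> (Suc k * n + j) div a" using a by (intro div_le_mono) simp
      also have "\<dots> \<le> (l * n + j) div a"
        using kl by (intro div_le_mono add_le_mono1 mult_le_mono1) simp
      finally show "(k * n + j) div a \<noteq> (l * n + j) div a" by simp
    qed auto
    ultimately show ?thesis by (simp add: card_image)
  qed
qed

text \<open>Enumerations of \<open>M\<close> and \<open>N\<close> carry the relation on initial
  segments over. Since both are injective, each row and column of \<open>R\<close> is a bijective
  copy of a single one of \<open>S\<close>.\<close>

lemma biregular_relation:
  assumes fin: "finite M" "finite N"
    and a: "0 < a" "a \<le> card N" and eq: "card M * a = card N * b"
  obtains R where "R \<subseteq> M \<times> N"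
    and "\<And>x. x \<in> M \<Longrightarrow> card {y. (x, y) \<in> R} = a"
    and "\<And>y. y \<in> N \<Longrightarrow> card {x. (x, y) \<in> R} = b"
proof -
  obtain S where S: "S \<subseteq> {..<card M} \<times> {..<card N}"
    and rows: "\<And>i. i < card M \<Longrightarrow> card {j. (i, j) \<in> S} = a"
    and cols: "\<And>j. j < card N \<Longrightarrow> card {i. (i, j) \<in> S} = b"
    by (rule biregular_relation_nat[OF a eq]) blast
  obtain f g where f: "bij_betw f {..<card M} M" and g: "bij_betw g {..<card N} N"
    using ex_bij_betw_nat_finite[OF fin(1)] ex_bij_betw_nat_finite[OF fin(2)]
    by (auto simp: atLeast0LessThan)
  note finj = bij_betw_imp_inj_on[OF f] and ginj = bij_betw_imp_inj_on[OF g]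
  define R where "R = map_prod f g ` S"
  show ?thesis
  proof
    show "R \<subseteq> M \<times> N"
      using S bij_betwE[OF f] bij_betwE[OF g] by (auto simp: R_def)
    show "card {y. (x, y) \<in> R} = a" if x: "x \<in> M" for x
    proof -
      obtain i where i: "i < card M" "x = f i"
        using x bij_betw_imp_surj_on[OF f] by auto
      have "{y. (x, y) \<in> R} = g ` {j. (i, j) \<in> S}"
      proof (intro equalityI subsetI)
        fix y assume "y \<in> {y. (x, y) \<in> R}"
        then obtain i' j where j: "(i', j) \<in> S" "f i' = f i" "y = g j"
          unfolding R_def i(2) by auto
        then have "i' = i" using S i(1) by (intro inj_onD[OF finj]) auto
        then show "y \<in> g ` {j. (i, j) \<in> S}" using j by blast
      qed (force simp: R_def i(2))
      moreover have "inj_on g {j. (i, j) \<in> S}"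
        using S by (intro inj_on_subset[OF ginj]) auto
      ultimately show ?thesis using rows[OF i(1)] by (simp add: card_image)
    qed
    show "card {x. (x, y) \<in> R} = b" if y: "y \<in> N" for y
    proof -
      obtain j where j: "j < card N" "y = g j"
        using y bij_betw_imp_surj_on[OF g] by auto
      have "{x. (x, y) \<in> R} = f ` {i. (i, j) \<in> S}"
      proof (intro equalityI subsetI)
        fix x assume "x \<in> {x. (x, y) \<in> R}"
        then obtain i j' where i: "(i, j') \<in> S" "g j' = g j" "x = f i"
          unfolding R_def j(2) by auto
        then have "j' = j" using S j(1) by (intro inj_onD[OF ginj]) auto
        then show "x \<in> f ` {i. (i, j) \<in> S}" using i by blast
      qed (force simp: R_def j(2))
      moreover have "inj_on f {i. (i, j) \<in> S}"
        using S by (intro inj_on_subset[OF finj]) auto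
      ultimately show ?thesis using cols[OF j(1)] by (simp add: card_image)
    qed
  qed
qed

section \<open>Neighbourhoods and lines in the Hamming graph on triples\<close>

lemma pverts_hamming_graph_3:
  "pverts (hamming_graph 3 A) = {[x, y, z] | x y z. x \<in> A \<and> y \<in> A \<and> z \<in> A}"
  by (auto simp: hamming_graph_def numeral_3_eq_3 length_Suc_conv)

lemma neighbours_hamming_graph_3:
  assumes "x \<in> A" "y \<in> A" "z \<in> A"
  shows "neighbours (hamming_graph 3 A) [x, y, z] =
    (\<lambda>x'. [x', y, z]) ` (A - {x}) \<union> (\<lambda>y'. [x, y', z]) ` (A - {y}) \<union>
    (\<lambda>z'. [x, y, z']) ` (A - {z})"
proof -
  \<comment> \<open>A sum of three indicators turns the Hamming distance of explicit triples into a
    case check.\<close>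
  have card: "card {i. i < 3 \<and> P i} = of_bool (P 0) + of_bool (P 1) + of_bool (P 2)"
    for P :: "nat \<Rightarrow> bool"
  proof -
    have "card {i. i < 3 \<and> P i} = (\<Sum>i<3. of_bool (P i))"
      by (simp add: sum_of_bool_eq Collect_conj_eq lessThan_def)
    then show ?thesis by (simp add: eval_nat_numeral)
  qed
  show ?thesis
  proof (rule set_eqI)
    fix v
    show "v \<in> neighbours (hamming_graph 3 A) [x, y, z] \<longleftrightarrow> v \<in> (\<lambda>x'. [x', y, z]) ` (A - {x}) \<union>
      (\<lambda>y'. [x, y', z]) ` (A - {y}) \<union> (\<lambda>z'. [x, y, z']) ` (A - {z})"
    proof (cases "v \<in> pverts (hamming_graph 3 A)")
      case True
      then obtain u v' w where [simp]: "v = [u, v', w]" and "u \<in> A" "v' \<in> A" "w \<in> A"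
        by (auto simp: pverts_hamming_graph_3)
      then show ?thesis
        using assms by (auto simp: neighbours_def hamming_graph_def card of_bool_def)
    next
      case False
      then show ?thesis
        using assms by (auto simp: neighbours_def hamming_graph_def)
    qed
  qed
qed

text \<open>The three lines through a point of \<open>C\<close> all contain the point itself.\<close>

lemma card_neighbours_inter_hamming_graph_3:
  assumes A: "finite A" and xyz: "x \<in> A" "y \<in> A" "z \<in> A"
  shows "card (neighbours (hamming_graph 3 A) [x, y, z] \<inter> C) + 3 * of_bool ([x, y, z] \<in> C) =
    card {x' \<in> A. [x', y, z] \<in> C} + card {y' \<in> A. [x, y', z] \<in> C} + card {z' \<in> A. [x, y, z'] \<in> C}"
proof -
  let ?X = "{x' \<in> A. [x', y, z] \<in> C}" and ?Y = "{y' \<in> A. [x, y', z] \<in> C}"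
    and ?Z = "{z' \<in> A. [x, y, z'] \<in> C}"
  let ?I = "(\<lambda>x'. [x', y, z]) ` (?X - {x})" and ?J = "(\<lambda>y'. [x, y', z]) ` (?Y - {y})"
    and ?K = "(\<lambda>z'. [x, y, z']) ` (?Z - {z})"
  have "neighbours (hamming_graph 3 A) [x, y, z] \<inter> C = ?I \<union> ?J \<union> ?K"
    unfolding neighbours_hamming_graph_3[OF xyz] by blast
  \<comment> \<open>Each punctured line changes its own coordinate and fixes the other two, so the
    three are disjoint.\<close>
  moreover have "card (?I \<union> ?J \<union> ?K) = card ?I + card ?J + card ?K"
  proof -
    have "finite ?I" "finite ?J" "finite ?K" "?I \<inter> ?J = {}" "(?I \<union> ?J) \<inter> ?K = {}"
      using A by auto
    then show ?thesis by (simp add: card_Un_disjoint)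
  qed
  moreover have "card ?I = card (?X - {x})" "card ?J = card (?Y - {y})" "card ?K = card (?Z - {z})"
    by (intro card_image; simp add: inj_on_def)+
  ultimately have *: "card (neighbours (hamming_graph 3 A) [x, y, z] \<inter> C) =
    card (?X - {x}) + card (?Y - {y}) + card (?Z - {z})" by (simp only:)
  have "card (S - {u}) + of_bool (u \<in> S) = card S" if "finite S" for S :: "'a set" and u
    using that card.remove by force
  from this[of ?X x] this[of ?Y y] this[of ?Z z] show ?thesis
    using * A xyz by simp
qed

text \<open>Along a line two of the three relations depend on the varying coordinate; they
  contribute \<open>S\<close> and \<open>T\<close>, kept disjoint by \<open>U\<close>. The third,
  \<open>P\<close>, is constant there: it fills the whole line, and then the other two contribute
  nothing.\<close>

lemma card_line:
  assumes A: "finite A" and S: "S \<subseteq> A \<inter> U" and T: "T \<subseteq> A - U"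
    and P: "P \<Longrightarrow> S = {} \<and> T = {}"
    and Q: "\<And>u. u \<in> A \<Longrightarrow> Q u \<longleftrightarrow> u \<in> S \<or> u \<in> T \<or> P"
  shows "card {u \<in> A. Q u} = card S + card T + card A * of_bool P"
proof (cases P)
  case True
  then have "{u \<in> A. Q u} = A" using Q by auto
  then show ?thesis using P True by simp
next
  case False
  then have "{u \<in> A. Q u} = S \<union> T" using S T Q by auto
  moreover have "finite S" "finite T" "S \<inter> T = {}"
    using S T A by (auto intro: finite_subset[OF _ A])
  ultimately show ?thesis using False by (simp add: card_Un_disjoint)
qed

section \<open>The code obtained from Condition 1\<close>

theorem theorem3:
  fixes A :: "'a set" and q \<gamma> :: int
  assumes "finite A" and "int (card A) = q" and "q \<ge> 2"
    and "condition1 q \<gamma>"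
  shows "\<exists>C \<beta>. completely_regular_code_radius1 (hamming_graph 3 A) C \<beta> \<gamma> \<and>
           code_eigenvalue (3 * (q - 1)) \<beta> \<gamma> = hamming_eigenvalue 2 3 q"
proof -
  note A = assms(1)
  obtain r' s' t' a' b' c' :: int where
    pos: "0 < r'" "r' < q" "0 < s'" "s' < q" "0 < t'" "t' < q" "0 < a'" "0 < b'" "0 < c'"
    and le: "c' \<le> q - s'" "c' \<le> q - t'" "b' \<le> t'" "b' \<le> q - r'" "a' \<le> r'" "a' \<le> s'"
    and eqs: "c' * r' = a' * (q - t')" "b' * (q - s') = c' * (q - r')" "a' * t' = b' * s'"
    and \<gamma>: "\<gamma> = a' + b' + c'"
    using assms(4) unfolding condition1_def by auto
  define r s t a b c where defs: "r = nat r'" "s = nat s'" "t = nat t'"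
    "a = nat a'" "b = nat b'" "c = nat c'"
  have ints: "r' = int r" "s' = int s" "t' = int t" "a' = int a" "b' = int b" "c' = int c"
    using pos by (simp_all add: defs)
  have lt: "r < card A" "s < card A" "t < card A"
    using pos assms(2) by (simp_all add: ints)
  obtain X where X: "X \<subseteq> A" "card X = t" using obtain_subset_with_card_n lt(3) less_imp_le by metis
  obtain Y where Y: "Y \<subseteq> A" "card Y = r" using obtain_subset_with_card_n lt(1) less_imp_le by metis
  obtain Z where Z: "Z \<subseteq> A" "card Z = s" using obtain_subset_with_card_n lt(2) less_imp_le by metis
  have fin: "finite X" "finite Y" "finite Z"
    using X Y Z A by (auto intro: finite_subset)
  have compl: "int (card (A - X)) = q - t'" "int (card (A - Y)) = q - r'" "int (card (A - Z)) = q - s'"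
    using X Y Z fin lt assms(2) by (simp_all add: card_Diff_subset ints of_nat_diff)
  \<comment> \<open>The bounds \<open>a' \<le> s'\<close>, \<open>b' \<le> q - r'\<close> and
    \<open>c' \<le> q - t'\<close> let the rows of \<open>F\<close>, \<open>G\<close> and
    \<open>H\<close> fit into \<open>Z\<close>, \<open>A - Y\<close> and
    \<open>A - X\<close>.\<close>
  obtain F where F: "F \<subseteq> X \<times> Z"
    and F_row: "\<And>x. x \<in> X \<Longrightarrow> card {z. (x, z) \<in> F} = a"
    and F_col: "\<And>z. z \<in> Z \<Longrightarrow> card {x. (x, z) \<in> F} = b"
  proof (rule biregular_relation[OF fin(1,3), of a b])
    have "int (card X * a) = int (card Z * b)"
      using X Z eqs(3) by (simp add: ints mult.commute)
    then show "card X * a = card Z * b" by (simp only: of_nat_eq_iff)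
  qed (use pos le X Z in \<open>auto simp: ints\<close>)
  obtain G where G: "G \<subseteq> (A - Z) \<times> (A - Y)"
    and G_row: "\<And>z. z \<in> A - Z \<Longrightarrow> card {y. (z, y) \<in> G} = b"
    and G_col: "\<And>y. y \<in> A - Y \<Longrightarrow> card {z. (z, y) \<in> G} = c"
  proof (rule biregular_relation[of "A - Z" "A - Y" b c])
    have "int (card (A - Z) * b) = int (card (A - Y) * c)"
      unfolding of_nat_mult compl using eqs(2) by (simp add: ints mult.commute)
    then show "card (A - Z) * b = card (A - Y) * c" by (simp only: of_nat_eq_iff)
    show "b \<le> card (A - Y)" using le compl by (simp add: ints)
  qed (use pos A in \<open>auto simp: ints\<close>)
  obtain H where H: "H \<subseteq> Y \<times> (A - X)"
    and H_row: "\<And>y. y \<in> Y \<Longrightarrow> card {x. (y, x) \<in> H} = c"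
    and H_col: "\<And>x. x \<in> A - X \<Longrightarrow> card {y. (y, x) \<in> H} = a"
  proof (rule biregular_relation[of Y "A - X" c a])
    have "int (card Y * c) = int (card (A - X) * a)"
      unfolding of_nat_mult compl using eqs(1) Y by (simp add: ints mult.commute)
    then show "card Y * c = card (A - X) * a" by (simp only: of_nat_eq_iff)
    show "c \<le> card (A - X)" using le compl by (simp add: ints)
  qed (use pos A fin in \<open>auto simp: ints\<close>)

  define C where "C = {[x, y, z] | x y z. x \<in> A \<and> y \<in> A \<and> z \<in> A \<and>
    ((x, z) \<in> F \<or> (z, y) \<in> G \<or> (y, x) \<in> H)}"
  have C_iff: "[x, y, z] \<in> C \<longleftrightarrow> (x, z) \<in> F \<or> (z, y) \<in> G \<or> (y, x) \<in> H"
    if "x \<in> A" "y \<in> A" "z \<in> A" for x y z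
    using that by (simp add: C_def)

  have count: "card (neighbours (hamming_graph 3 A) v \<inter> C) + 3 * of_bool (v \<in> C) =
      a + b + c + card A * of_bool (v \<in> C)" if v_in: "v \<in> pverts (hamming_graph 3 A)" for v
  proof -
    obtain x y z where v: "v = [x, y, z]" and xyz: "x \<in> A" "y \<in> A" "z \<in> A"
      using v_in by (auto simp: pverts_hamming_graph_3)
    \<comment> \<open>Rows and columns indexed outside the two sides of a relation are empty, whence
      the indicator factors.\<close>
    have F0: "card {z. (x, z) \<in> F} = a * of_bool (x \<in> X)" "card {x. (x, z) \<in> F} = b * of_bool (z \<in> Z)"
      using F_row[of x] F_col[of z] F by (auto simp: of_bool_def card_eq_0_iff)
    have G0: "card {y. (z, y) \<in> G} = b * of_bool (z \<notin> Z)" "card {z. (z, y) \<in> G} = c * of_bool (y \<notin> Y)"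
      using G_row[of z] G_col[of y] G xyz by (auto simp: of_bool_def card_eq_0_iff)
    have H0: "card {x. (y, x) \<in> H} = c * of_bool (y \<in> Y)" "card {y. (y, x) \<in> H} = a * of_bool (x \<notin> X)"
      using H_row[of y] H_col[of x] H xyz by (auto simp: of_bool_def card_eq_0_iff)
    \<comment> \<open>Column \<open>z\<close> of \<open>F\<close> lies in \<open>X\<close>, row
      \<open>y\<close> of \<open>H\<close> in \<open>A - X\<close>. If
      \<open>(z, y) \<in> G\<close>, then \<open>z \<notin> Z\<close> and
      \<open>y \<notin> Y\<close>, so both are empty. The other two directions are alike, split by
      \<open>Y\<close> and \<open>Z\<close>.\<close>
    have 1: "card {x' \<in> A. [x', y, z] \<in> C} =
        b * of_bool (z \<in> Z) + c * of_bool (y \<in> Y) + card A * of_bool ((z, y) \<in> G)"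
      unfolding F0[symmetric] H0[symmetric]
      by (rule card_line[OF A, where U = X]) (use xyz C_iff F G H X in auto)
    have 2: "card {y' \<in> A. [x, y', z] \<in> C} =
        a * of_bool (x \<notin> X) + b * of_bool (z \<notin> Z) + card A * of_bool ((x, z) \<in> F)"
      unfolding G0[symmetric] H0[symmetric]
      by (rule card_line[OF A, where U = Y]) (use xyz C_iff F G H Y in auto)
    have 3: "card {z' \<in> A. [x, y, z'] \<in> C} =
        a * of_bool (x \<in> X) + c * of_bool (y \<notin> Y) + card A * of_bool ((y, x) \<in> H)"
      unfolding F0[symmetric] G0[symmetric]
      by (rule card_line[OF A, where U = Z]) (use xyz C_iff F G H Z in auto)
    \<comment> \<open>Indicators add because the relations exclude each other: \<open>F\<close> and
      \<open>G\<close> disagree on \<open>z \<in> Z\<close>, \<open>G\<close> and \<open>H\<close>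
      on \<open>y \<in> Y\<close>, \<open>H\<close> and \<open>F\<close> on
      \<open>x \<in> X\<close>.\<close>
    have 4: "of_bool (v \<in> C) =
        (of_bool ((z, y) \<in> G) + of_bool ((x, z) \<in> F) + of_bool ((y, x) \<in> H) :: nat)"
      using F G H C_iff[OF xyz] unfolding v by (auto simp: of_bool_def)
    \<comment> \<open>In the sum over the three lines each indicator meets its complement, so
      \<open>a\<close>, \<open>b\<close> and \<open>c\<close> each occur once.\<close>
    have split: "k * of_bool P + k * of_bool (\<not> P) = k" for k :: nat and P
      by (cases P) simp_all
    have "card A * of_bool (v \<in> C) = card A * of_bool ((z, y) \<in> G) +
        card A * of_bool ((x, z) \<in> F) + card A * of_bool ((y, x) \<in> H)"
      by (simp only: 4 distrib_left)
    then show ?thesis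
      using card_neighbours_inter_hamming_graph_3[OF A xyz, of C]
        split[of a "x \<in> X"] split[of b "z \<in> Z"] split[of c "y \<in> Y"]
      unfolding 1 2 3 v[symmetric] by linarith
  qed

  \<comment> \<open>A triple with \<open>x \<in> X\<close>, \<open>y \<in> Y\<close>,
    \<open>z \<notin> Z\<close> avoids \<open>F\<close> by \<open>z\<close>, \<open>G\<close> by
    \<open>y\<close> and \<open>H\<close> by \<open>x\<close>. Replacing \<open>z\<close> by an
    \<open>F\<close>-partner of \<open>x\<close> gives a code point.\<close>
  have "card X \<noteq> 0" "card Y \<noteq> 0" "card (A - Z) \<noteq> 0"
    using X Y compl(3) pos by (auto simp: ints)
  then obtain x y z where xyz: "x \<in> X" "y \<in> Y" "z \<in> A - Z"
    by (metis card.empty ex_in_conv)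
  have "card {z. (x, z) \<in> F} \<noteq> 0"
    using F_row[OF xyz(1)] pos by (simp add: ints)
  then obtain w where "(x, w) \<in> F" by (metis card.empty empty_Collect_eq)
  then have "[x, y, w] \<in> C" using xyz F X Y Z C_iff[of x y w] by auto
  then have nonempty: "C \<noteq> {}" by blast
  have "[x, y, z] \<notin> C" using xyz F G H unfolding C_def by auto
  moreover have "[x, y, z] \<in> pverts (hamming_graph 3 A)"
    using xyz X Y by (auto simp: pverts_hamming_graph_3)
  moreover have sub: "C \<subseteq> pverts (hamming_graph 3 A)"
    by (auto simp: C_def pverts_hamming_graph_3)
  ultimately have proper: "C \<subset> pverts (hamming_graph 3 A)" by blast

  \<comment> \<open>By \<open>count\<close> a code point has \<open>\<gamma> + q - 3\<close>
    neighbours in \<open>C\<close>, which leaves \<open>3 * (q - 1) - (\<gamma> + q - 3)\<close>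
    outside.\<close>
  have outside: "int (card (neighbours (hamming_graph 3 A) v - C)) = 2 * q - \<gamma>" if "v \<in> C" for v
  proof -
    let ?N = "neighbours (hamming_graph 3 A) v"
    have v: "v \<in> pverts (hamming_graph 3 A)" using that sub by blast
    have N: "card ?N = 3 * (card A - 1)" by (rule card_neighbours_hamming_graph[OF A v])
    \<comment> \<open>Infinite sets have \<open>card\<close> 0, while \<open>q \<ge> 2\<close> makes
      this degree positive.\<close>
    then have "finite ?N" using assms(2,3) by (intro card_ge_0_finite) simp
    then have "card ?N = card (?N \<inter> C) + card (?N - C)"
      by (rule card_Int_Diff)
    then show ?thesis using count[OF v] N that assms(2,3) by (simp add: \<gamma> ints)
  qed
  have inside: "int (card (neighbours (hamming_graph 3 A) v \<inter> C)) = \<gamma>"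
    if "v \<in> pverts (hamming_graph 3 A) - C" for v
    using count[of v] that by (simp add: \<gamma> ints)
  \<comment> \<open>For \<open>2 * q - \<gamma> \<ge> 1\<close>: \<open>a' \<le> r'\<close> and
    \<open>b' \<le> q - r'\<close> give \<open>a' + b' \<le> q\<close>, and
    \<open>c' \<le> q - s' < q\<close>.\<close>
  have "completely_regular_code_radius1 (hamming_graph 3 A) C (2 * q - \<gamma>) \<gamma>"
    unfolding completely_regular_code_radius1_def
    using nonempty proper outside inside pos le by (simp add: \<gamma>)
  moreover have "code_eigenvalue (3 * (q - 1)) (2 * q - \<gamma>) \<gamma> = hamming_eigenvalue 2 3 q"
    by (simp add: code_eigenvalue_def hamming_eigenvalue_2_3)
  ultimately show ?thesis by blast
qed

end
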